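(* Let $L$ be an even lattice of signature $(2,1)$ with discriminant form $(\mathcal D,q)$. Every (weakly holomorphic) modular form $F=\sum_\gamma F_\gamma\mathfrak e_\gamma$ of weight $1/2$ for the Weil representation $\overline\rho_L$ has components odd under $\gamma\mapsto-\gamma$: $F_{-\gamma}=-F_\gamma$. Consequently: (i) all coefficients on two-torsion cosets vanish identically, i.e. $F_\mu=0$ whenever $2\mu=0$ in $\mathcal D$; in particular every reflective slot $(\mu,m)$ with $2\mu=0$ is invisible at weight $1/2$; (ii) the only reflective prescriptions available at weight $1/2$ are the odd ones, supported on the non-torsion slot pairs $\{\mu,-\mu\}$ ($2\mu\ne0$) with antisymmetric coefficients.
   Context: $\mathcal D=L^\vee/L$, $q(\gamma)=(\gamma,\gamma)/2\bmod1$, $e(x)=e^{2\pi ix}$. $\mathrm{Mp}_2(\mathbb Z)$ consists of pairs $(A,\varphi)$, $A\in\mathrm{SL}_2(\mathbb Z)$, $\varphi(\tau)^2=c\tau+d$. $\rho_L$ is the representation on $\mathbb C[\mathcal D]$ with $\rho_L(T)\mathfrak e_\gamma=e(q(\gamma))\mathfrak e_\gamma$, $\rho_L(S)\mathfrak e_\gamma=\frac{e(-1/8)}{\sqrt{|\mathcal D|}}\sum_\delta e(-(\gamma,\delta))\mathfrak e_\delta$, where $T=(\left(\begin{smallmatrix}1&1\\0&1\end{smallmatrix}\right),1)$, $S=(\left(\begin{smallmatrix}0&-1\\1&0\end{smallmatrix}\right),\sqrt\tau)$; $\overline\rho_L$ is its complex conjugate, so $\overline\rho_L(T)\mathfrak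 e_\gamma=e(-q(\gamma))\mathfrak e_\gamma$. Modular forms of weight $k$ for $\overline\rho_L$ satisfy $F(A\tau)=\varphi(\tau)^{2k}\overline\rho_L(A,\varphi)F(\tau)$. A root is a primitive $\alpha\in L$ with $\alpha^2>0$ whose reflection preserves $L$; with $\ell>0$ generating the ideal $(\alpha,L)$, its reflective slot is the pair $(\mu,m)=(\alpha/\ell+L,\alpha^2/(2\ell^2))$. A reflective prescription is a principal part $\sum a(\mu,m)q^{-m}\mathfrak e_\mu$ supported on reflective slots; it is available at weight $1/2$ if it can occur as the principal part of a weight-$1/2$ weakly holomorphic form for $\overline\rho_L$ as far as the parity constraint is concerned, i.e. if it is odd: $a(-\mu,m)=-a(\mu,m)$. *)

theory Defs
  imports
    "HOL-Analysis.Analysis"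
    "HOL-Algebra.Coset"
    "HOL-Algebra.Bij"
begin

section \<open>Even lattices and their discriminant forms\<close>

definition int_span :: "'v::real_vector set \<Rightarrow> 'v set" where
  "int_span S = {\<Sum>b\<in>S. real_of_int (n b) *\<^sub>R b | n. True}"

definition full_lattice :: "'v::real_vector set \<Rightarrow> bool" where
  "full_lattice L \<longleftrightarrow>
     (\<exists>S. finite S \<and> independent S \<and> span S = UNIV \<and> L = int_span S)"

text \<open>The lattice is realised inside its quadratic space \<open>L \<otimes> \<real>\<close>, which is the whole
  type \<open>'v\<close>; \<open>B x y\<close> is the bilinear form \<open>(x, y)\<close>.\<close>

definition even_lattice :: "('v::real_vector \<Rightarrow> 'v \<Rightarrow> real) \<Rightarrow> 'v set \<Rightarrow> bool" where
  "even_lattice B L \<longleftrightarrow>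
     bilinear B \<and> (\<forall>x y. B x y = B y x) \<and> full_lattice L \<and>
     (\<forall>x\<in>L. \<forall>y\<in>L. B x y \<in> \<int>) \<and> (\<forall>x\<in>L. B x x / 2 \<in> \<int>)"

definition has_signature :: "('v::real_vector \<Rightarrow> 'v \<Rightarrow> real) \<Rightarrow> nat \<Rightarrow> nat \<Rightarrow> bool" where
  "has_signature B p n \<longleftrightarrow>
     (\<exists>P N. finite P \<and> finite N \<and> P \<inter> N = {} \<and> card P = p \<and> card N = n \<and>
        independent (P \<union> N) \<and> span (P \<union> N) = UNIV \<and>
        (\<forall>x\<in>P \<union> N. \<forall>y\<in>P \<union> N. x \<noteq> y \<longrightarrow> B x y = 0) \<and>
        (\<forall>x\<in>P. B x x > 0) \<and> (\<forall>x\<in>N. B x x < 0))"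

definition dual_lattice :: "('v::real_vector \<Rightarrow> 'v \<Rightarrow> real) \<Rightarrow> 'v set \<Rightarrow> 'v set" where
  "dual_lattice B L = {x. \<forall>y\<in>L. B x y \<in> \<int>}"

definition dual_group :: "('v::real_vector \<Rightarrow> 'v \<Rightarrow> real) \<Rightarrow> 'v set \<Rightarrow> 'v monoid" where
  "dual_group B L = \<lparr>carrier = dual_lattice B L, mult = (+), one = 0\<rparr>"

text \<open>The quotient \<open>L\<^sup>\<or>/L\<close> is written multiplicatively, following HOL-Algebra: \<open>-\<gamma>\<close> is the
  group inverse of \<open>\<gamma>\<close>, and \<open>2\<mu> = 0\<close> reads \<open>\<mu> \<otimes> \<mu> = \<one>\<close>.\<close>

definition disc_group :: "('v::real_vector \<Rightarrow> 'v \<Rightarrow> real) \<Rightarrow> 'v set \<Rightarrow> 'v set monoid" where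
  "disc_group B L = dual_group B L Mod L"

abbreviation disc :: "('v::real_vector \<Rightarrow> 'v \<Rightarrow> real) \<Rightarrow> 'v set \<Rightarrow> 'v set set" where
  "disc B L \<equiv> carrier (disc_group B L)"

abbreviation disc_neg ::
    "('v::real_vector \<Rightarrow> 'v \<Rightarrow> real) \<Rightarrow> 'v set \<Rightarrow> 'v set \<Rightarrow> 'v set" where
  "disc_neg B L \<gamma> \<equiv> inv\<^bsub>disc_group B L\<^esub> \<gamma>"

definition two_torsion :: "('v::real_vector \<Rightarrow> 'v \<Rightarrow> real) \<Rightarrow> 'v set \<Rightarrow> 'v set \<Rightarrow> bool" where
  "two_torsion B L \<mu> \<longleftrightarrow>
     \<mu> \<in> disc B L \<and> \<mu> \<otimes>\<^bsub>disc_group B L\<^esub> \<mu> = \<one>\<^bsub>disc_group B L\<^esub>"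

text \<open>Elements of \<open>\<real>/\<int>\<close> are represented in \<open>[0,1)\<close>; on an even lattice the values below do
  not depend on the chosen representatives of the cosets.\<close>

definition disc_q :: "('v::real_vector \<Rightarrow> 'v \<Rightarrow> real) \<Rightarrow> 'v set \<Rightarrow> real" where
  "disc_q B \<gamma> = frac (B (SOME x. x \<in> \<gamma>) (SOME x. x \<in> \<gamma>) / 2)"

definition disc_pairing :: "('v::real_vector \<Rightarrow> 'v \<Rightarrow> real) \<Rightarrow> 'v set \<Rightarrow> 'v set \<Rightarrow> real" where
  "disc_pairing B \<gamma> \<delta> = frac (B (SOME x. x \<in> \<gamma>) (SOME y. y \<in> \<delta>))"


section \<open>The metaplectic group\<close>

definition upper_half_plane :: "complex set" where
  "upper_half_plane = {\<tau>. Im \<tau> > 0}"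

definition moebius_action :: "int^2^2 \<Rightarrow> complex \<Rightarrow> complex" where
  "moebius_action A \<tau> =
     (of_int (A$1$1) * \<tau> + of_int (A$1$2)) / (of_int (A$2$1) * \<tau> + of_int (A$2$2))"

type_synonym metaplectic = "(int^2^2) \<times> (complex \<Rightarrow> complex)"

text \<open>The functions \<open>\<phi>\<close> live on the upper half plane; they are made \<open>extensional\<close> so that
  equality of pairs is the intended one.\<close>

definition Mp2Z :: "metaplectic monoid" where
  "Mp2Z = \<lparr>
     carrier = {(A, \<phi>). det A = 1 \<and> \<phi> \<in> extensional upper_half_plane \<and>
        \<phi> holomorphic_on upper_half_plane \<and>
        (\<forall>\<tau>\<in>upper_half_plane. (\<phi> \<tau>)\<^sup>2 = of_int (A$2$1) * \<tau> + of_int (A$2$2))},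
     mult = (\<lambda>(A, \<phi>) (A', \<phi>').
        (A ** A', restrict (\<lambda>\<tau>. \<phi> (moebius_action A' \<tau>) * \<phi>' \<tau>) upper_half_plane)),
     one = (mat 1, restrict (\<lambda>_. 1) upper_half_plane)\<rparr>"

definition Mp2_T :: "metaplectic" where
  "Mp2_T = (vector [vector [1, 1], vector [0, 1]], restrict (\<lambda>_. 1) upper_half_plane)"

definition Mp2_S :: "metaplectic" where
  "Mp2_S = (vector [vector [0, -1], vector [1, 0]], restrict csqrt upper_half_plane)"


section \<open>The Weil representation\<close>

definition ee :: "complex \<Rightarrow> complex" where
  "ee x = exp (2 * of_real pi * \<i> * x)"

text \<open>\<open>\<complex>[\<D>]\<close> as the space of complex functions supported on the discriminant group.\<close>

definition group_space ::
    "('v::real_vector \<Rightarrow> 'v \<Rightarrow> real) \<Rightarrow> 'v set \<Rightarrow> ('v set \<Rightarrow> complex) set" where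
  "group_space B L = {v. \<forall>\<gamma>. \<gamma> \<notin> disc B L \<longrightarrow> v \<gamma> = 0}"

definition basis_vec :: "'g \<Rightarrow> 'g \<Rightarrow> complex" where
  "basis_vec \<gamma> = (\<lambda>\<delta>. if \<delta> = \<gamma> then 1 else 0)"

text \<open>The prefactor \<open>e(-1/8)\<close> is \<open>e(-(b\<^sup>+ - b\<^sup>-)/8)\<close> for signature \<open>(b\<^sup>+, b\<^sup>-) = (2, 1)\<close>.
  Since \<open>T\<close> and \<open>S\<close> generate the metaplectic group, at most one \<open>\<rho>\<close> satisfies this.\<close>

definition weil_representation ::
    "('v::real_vector \<Rightarrow> 'v \<Rightarrow> real) \<Rightarrow> 'v set \<Rightarrow>
     (metaplectic \<Rightarrow> ('v set \<Rightarrow> complex) \<Rightarrow> ('v set \<Rightarrow> complex)) \<Rightarrow> bool" where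
  "weil_representation B L \<rho> \<longleftrightarrow>
     \<rho> \<in> hom Mp2Z (BijGroup (group_space B L)) \<and>
     (\<forall>g\<in>carrier Mp2Z. \<forall>a. \<forall>v\<in>group_space B L. \<forall>w\<in>group_space B L.
        \<rho> g (\<lambda>\<gamma>. a * v \<gamma> + w \<gamma>) = (\<lambda>\<gamma>. a * \<rho> g v \<gamma> + \<rho> g w \<gamma>)) \<and>
     (\<forall>\<gamma>\<in>disc B L.
        \<rho> Mp2_T (basis_vec \<gamma>) = (\<lambda>\<delta>. ee (of_real (disc_q B \<gamma>)) * basis_vec \<gamma> \<delta>)) \<and>
     (\<forall>\<gamma>\<in>disc B L.
        \<rho> Mp2_S (basis_vec \<gamma>) =
          (\<lambda>\<epsilon>. ee (- 1 / 8) / of_real (sqrt (real (card (disc B L)))) *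
             (\<Sum>\<delta>\<in>disc B L. ee (- of_real (disc_pairing B \<gamma> \<delta>)) * basis_vec \<delta> \<epsilon>)))"

definition conj_rep ::
    "('m \<Rightarrow> ('g \<Rightarrow> complex) \<Rightarrow> ('g \<Rightarrow> complex)) \<Rightarrow> 'm \<Rightarrow> ('g \<Rightarrow> complex) \<Rightarrow> ('g \<Rightarrow> complex)" where
  "conj_rep \<rho> g v = (\<lambda>\<gamma>. cnj (\<rho> g (\<lambda>\<delta>. cnj (v \<delta>)) \<gamma>))"


section \<open>Weakly holomorphic modular forms for the conjugate Weil representation\<close>

text \<open>\<open>c \<gamma> n\<close> is the coefficient of \<open>q\<^sup>n \<ee>\<^sub>\<gamma>\<close>. The exponents lie in \<open>-q(\<gamma>) + \<int>\<close> because the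
  conjugate representation sends \<open>\<ee>\<^sub>\<gamma>\<close> to \<open>e(-q(\<gamma>)) \<ee>\<^sub>\<gamma>\<close> under \<open>T\<close>. The lower bound on the
  exponents expresses meromorphy at the cusp.\<close>

definition fourier_expansion ::
    "('v::real_vector \<Rightarrow> 'v \<Rightarrow> real) \<Rightarrow> 'v set \<Rightarrow> (complex \<Rightarrow> 'v set \<Rightarrow> complex) \<Rightarrow>
     ('v set \<Rightarrow> real \<Rightarrow> complex) \<Rightarrow> bool" where
  "fourier_expansion B L F c \<longleftrightarrow>
     (\<forall>\<gamma> n. c \<gamma> n \<noteq> 0 \<longrightarrow> \<gamma> \<in> disc B L \<and> n + disc_q B \<gamma> \<in> \<int>) \<and>
     (\<exists>N. \<forall>\<gamma> n. n < N \<longrightarrow> c \<gamma> n = 0) \<and>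
     (\<forall>\<gamma>\<in>disc B L. \<forall>\<tau>\<in>upper_half_plane.
        ((\<lambda>n. c \<gamma> n * ee (of_real n * \<tau>)) has_sum F \<tau> \<gamma>) UNIV)"

text \<open>\<open>k\<close> is the weight, a half-integer, so that \<open>\<phi>(\<tau>)\<^sup>2\<^sup>k\<close> is an integral power.\<close>

definition weakly_holomorphic_form ::
    "('v::real_vector \<Rightarrow> 'v \<Rightarrow> real) \<Rightarrow> 'v set \<Rightarrow>
     (metaplectic \<Rightarrow> ('v set \<Rightarrow> complex) \<Rightarrow> ('v set \<Rightarrow> complex)) \<Rightarrow>
     real \<Rightarrow> (complex \<Rightarrow> 'v set \<Rightarrow> complex) \<Rightarrow> bool" where
  "weakly_holomorphic_form B L \<rho> k F \<longleftrightarrow>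
     2 * k \<in> \<int> \<and>
     (\<forall>\<tau>\<in>upper_half_plane. F \<tau> \<in> group_space B L) \<and>
     (\<forall>\<gamma>\<in>disc B L. (\<lambda>\<tau>. F \<tau> \<gamma>) holomorphic_on upper_half_plane) \<and>
     (\<forall>(A, \<phi>)\<in>carrier Mp2Z. \<forall>\<tau>\<in>upper_half_plane.
        F (moebius_action A \<tau>) = (\<lambda>\<gamma>. \<phi> \<tau> powi \<lfloor>2 * k\<rfloor> * conj_rep \<rho> (A, \<phi>) (F \<tau>) \<gamma>)) \<and>
     (\<exists>c. fourier_expansion B L F c)"


section \<open>Roots, reflective slots and reflective prescriptions\<close>

definition primitive :: "'v::real_vector set \<Rightarrow> 'v \<Rightarrow> bool" where
  "primitive L \<alpha> \<longleftrightarrow> \<alpha> \<in> L \<and> \<alpha> \<noteq> 0 \<and>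
     (\<forall>n::int. \<forall>\<beta>\<in>L. \<alpha> = real_of_int n *\<^sub>R \<beta> \<longrightarrow> \<bar>n\<bar> = 1)"

definition reflection :: "('v::real_vector \<Rightarrow> 'v \<Rightarrow> real) \<Rightarrow> 'v \<Rightarrow> 'v \<Rightarrow> 'v" where
  "reflection B \<alpha> x = x - (2 * B x \<alpha> / B \<alpha> \<alpha>) *\<^sub>R \<alpha>"

definition lattice_root :: "('v::real_vector \<Rightarrow> 'v \<Rightarrow> real) \<Rightarrow> 'v set \<Rightarrow> 'v \<Rightarrow> bool" where
  "lattice_root B L \<alpha> \<longleftrightarrow> primitive L \<alpha> \<and> B \<alpha> \<alpha> > 0 \<and> reflection B \<alpha> ` L = L"

definition reflective_slot ::
    "('v::real_vector \<Rightarrow> 'v \<Rightarrow> real) \<Rightarrow> 'v set \<Rightarrow> 'v set \<Rightarrow> real \<Rightarrow> bool" where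
  "reflective_slot B L \<mu> m \<longleftrightarrow>
     (\<exists>\<alpha> (l::int). lattice_root B L \<alpha> \<and> l > 0 \<and>
        {B \<alpha> x | x. x \<in> L} = {real_of_int (l * n) | n. True} \<and>
        \<mu> = L #>\<^bsub>dual_group B L\<^esub> (\<alpha> /\<^sub>R real_of_int l) \<and>
        m = B \<alpha> \<alpha> / (2 * (real_of_int l)\<^sup>2))"

text \<open>A principal part \<open>\<Sum> a(\<mu>,m) q\<^sup>-\<^sup>m \<ee>\<^sub>\<mu>\<close> is given by its coefficient function \<open>a\<close>; note that
  \<open>a \<mu> m\<close> belongs to the exponent \<open>-m\<close>. Reflective slots have \<open>m > 0\<close>.\<close>

definition reflective_prescription ::
    "('v::real_vector \<Rightarrow> 'v \<Rightarrow> real) \<Rightarrow> 'v set \<Rightarrow> ('v set \<Rightarrow> real \<Rightarrow> complex) \<Rightarrow> bool" where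
  "reflective_prescription B L a \<longleftrightarrow>
     finite {(\<mu>, m). a \<mu> m \<noteq> 0} \<and> (\<forall>\<mu> m. a \<mu> m \<noteq> 0 \<longrightarrow> reflective_slot B L \<mu> m)"

definition has_principal_part ::
    "('v::real_vector \<Rightarrow> 'v \<Rightarrow> real) \<Rightarrow> 'v set \<Rightarrow> (complex \<Rightarrow> 'v set \<Rightarrow> complex) \<Rightarrow>
     ('v set \<Rightarrow> real \<Rightarrow> complex) \<Rightarrow> bool" where
  "has_principal_part B L F a \<longleftrightarrow>
     (\<exists>c. fourier_expansion B L F c \<and> a = (\<lambda>\<mu> m. if m > 0 then c \<mu> (- m) else 0))"

text \<open>The parity constraint at weight \<open>1/2\<close>.\<close>

definition available_at_half ::
    "('v::real_vector \<Rightarrow> 'v \<Rightarrow> real) \<Rightarrow> 'v set \<Rightarrow> ('v set \<Rightarrow> real \<Rightarrow> complex) \<Rightarrow> bool" where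
  "available_at_half B L a \<longleftrightarrow>
     reflective_prescription B L a \<and> (\<forall>\<mu>\<in>disc B L. \<forall>m. a (disc_neg B L \<mu>) m = - a \<mu> m)"

definition invisible_slot ::
    "('v::real_vector \<Rightarrow> 'v \<Rightarrow> real) \<Rightarrow> 'v set \<Rightarrow>
     (metaplectic \<Rightarrow> ('v set \<Rightarrow> complex) \<Rightarrow> ('v set \<Rightarrow> complex)) \<Rightarrow>
     real \<Rightarrow> 'v set \<Rightarrow> real \<Rightarrow> bool" where
  "invisible_slot B L \<rho> k \<mu> m \<longleftrightarrow>
     (\<forall>F c. weakly_holomorphic_form B L \<rho> k F \<and> fourier_expansion B L F c \<longrightarrow> c \<mu> (- m) = 0)"

end

(* Applying the transformation law for S twice gives the action of (-1, i), which fixes the upper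
   half plane. The double transform on C[D] sends e_gamma to i e_{-gamma} for the conjugate Weil
   representation, while the automorphy factor is sqrt(-1/tau) sqrt(tau) = i, so that
   F_gamma = i * i * F_{-gamma}. The parity passes to Fourier coefficients by uniqueness of the
   expansion. Finiteness of D and nondegeneracy of its pairing, needed for S^2, are not taken from
   lattice theory: they follow from the injectivity of rho(S). *)

theory Submission
  imports Defs
begin

section \<open>The exponential \<open>ee\<close> and its periodicity\<close>

lemma ee_add: "ee (x + y) = ee x * ee y"
  by (simp add: ee_def ring_distribs exp_add)

lemma ee_of_nat_mult: "ee (of_nat n * x) = ee x ^ n"
  by (simp add: ee_def exp_of_nat_mult [symmetric] mult_ac)

lemma ee_of_real_Ints: "r \<in> \<int> \<Longrightarrow> ee (of_real r) = 1"
  by (auto simp: ee_def Ints_def mult_ac exp_eq_1)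

lemma ee_cong_Ints:
  assumes "r - s \<in> \<int>"
  shows "ee (of_real r) = ee (of_real s)"
proof -
  have "ee (of_real r) = ee (of_real s + of_real (r - s))"
    by simp
  then show ?thesis
    by (simp only: ee_add ee_of_real_Ints [OF assms] mult_1_right)
qed

lemma ee_frac [simp]: "ee (of_real (frac r)) = ee (of_real r)"
  by (rule ee_cong_Ints) (simp add: frac_def)

lemma cnj_ee_of_real: "cnj (ee (of_real r)) = ee (- of_real r)"
  by (simp add: ee_def exp_cnj)

lemma ee_quarter: "ee (1/4) = \<i>"
  by (simp add: ee_def exp_eq_polar complex_eq_iff)

section \<open>Uniqueness of Fourier expansions\<close>

text \<open>With \<open>x = ee \<tau>\<close> and the lowest exponent factored out, the expansion
  becomes a power series with sum 0 on the punctured unit disc. Its constant term, the limit at 0,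
  must vanish, yet it is the first nonzero coefficient. The parameter \<open>r\<close> fixes the
  class of the exponents modulo 1.\<close>

lemma fourier_coeffs_eq_0:
  fixes c :: "real \<Rightarrow> complex"
  assumes supp: "\<And>n. c n \<noteq> 0 \<Longrightarrow> n + r \<in> \<int>"
    and bdd: "\<And>n. n < N \<Longrightarrow> c n = 0"
    and sum: "\<And>\<tau>. Im \<tau> > 0 \<Longrightarrow> ((\<lambda>n. c n * ee (of_real n * \<tau>)) has_sum 0) UNIV"
  shows "c n = 0"
proof (rule ccontr)
  assume n: "c n \<noteq> 0"
  \<comment> \<open>Going down from \<open>n\<close> by \<open>K\<close> lands strictly below
    \<open>N\<close>, so the support lies in \<open>M\<close> plus the natural numbers and has a
    least element, at \<open>k\<close>.\<close>
  define K where "K = nat \<lceil>n - N\<rceil> + 1"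
  define M where "M = n - real K"
  define k where "k = (LEAST k. c (M + real k) \<noteq> 0)"
  have MN: "M < N"
    unfolding M_def K_def by linarith
  have "c (M + real K) \<noteq> 0"
    using n by (simp add: M_def)
  then have k: "c (M + real k) \<noteq> 0"
    unfolding k_def by (rule LeastI)
  define a where "a = (\<lambda>i::nat. c (M + real k + real i))"
  have outside: "c m = 0" if m: "m \<notin> range (\<lambda>i::nat. M + real k + real i)" for m
  proof (rule ccontr)
    assume cm: "c m \<noteq> 0"
    have "m - M = (m + r) - (n + r) + real K"
      by (simp add: M_def)
    also have "\<dots> \<in> \<int>"
      by (rule Ints_add [OF Ints_diff [OF supp [OF cm] supp [OF n]] Ints_of_nat])
    finally obtain z where z: "m - M = of_int z"
      by (auto elim: Ints_cases)
    have "\<not> m < N"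
      using bdd cm by blast
    with MN z have "z \<ge> 0"
      by linarith
    then have m': "m = M + real (nat z)"
      using z by simp
    with cm have "k \<le> nat z"
      unfolding k_def by (metis Least_le)
    then have "m = M + real k + real (nat z - k)"
      using m' by (simp add: of_nat_diff)
    with m show False
      by blast
  qed
  have "(\<lambda>i. a i * x ^ i) sums 0" if x: "x \<noteq> 0" "norm x < 1" for x
  proof -
    \<comment> \<open>\<open>Ln\<close> supplies a preimage of \<open>x\<close> under
      \<open>ee\<close>; the condition \<open>norm x < 1\<close> puts it in the upper half
      plane.\<close>
    define \<tau> where "\<tau> = Ln x / (2 * of_real pi * \<i>)"
    have "Im \<tau> = - ln (norm x) / (2 * pi)"
      using x by (simp add: \<tau>_def Im_divide power2_eq_square)
    then have "Im \<tau> > 0"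
      using x by (simp add: ln_less_zero divide_neg_pos)
    have ee: "ee \<tau> = x"
      using x by (simp add: ee_def \<tau>_def)
    define h where "h = (\<lambda>i::nat. M + real k + real i)"
    have "((\<lambda>n. c n * ee (of_real n * \<tau>)) has_sum 0) (range h)"
      using sum [OF \<open>Im \<tau> > 0\<close>]
      by (rule has_sum_cong_neutral [THEN iffD1, rotated -1]) (use outside in \<open>auto simp: h_def\<close>)
    moreover have "inj h"
      by (auto simp: h_def inj_def)
    ultimately have "(((\<lambda>n. c n * ee (of_real n * \<tau>)) \<circ> h) has_sum 0) UNIV"
      by (simp add: has_sum_reindex)
    then have "((\<lambda>i. c (h i) * ee (of_real (h i) * \<tau>)) has_sum 0) UNIV"
      by (simp add: o_def)
    \<comment> \<open>This factor shifts the lowest exponent to 0, leaving integral powers of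
      \<open>x\<close>.\<close>
    from has_sum_cmult_right [OF this, of "ee (- (of_real (M + real k) * \<tau>))"]
    have "((\<lambda>i. ee (- (of_real (M + real k) * \<tau>)) *
        (c (h i) * ee (of_real (h i) * \<tau>))) has_sum 0) UNIV"
      by simp
    moreover have "ee (- (of_real (M + real k) * \<tau>)) * (c (h i) * ee (of_real (h i) * \<tau>))
        = a i * x ^ i" for i
    proof -
      have "ee (- (of_real (M + real k) * \<tau>)) * ee (of_real (h i) * \<tau>) = ee (of_nat i * \<tau>)"
        unfolding h_def ee_add [symmetric] by (simp add: algebra_simps)
      moreover have "ee (of_nat i * \<tau>) = x ^ i"
        by (simp add: ee_of_nat_mult ee)
      ultimately show ?thesis
        by (simp add: a_def h_def mult.left_commute)
    qed
    ultimately show ?thesis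
      by (simp add: has_sum_imp_sums)
  qed
  \<comment> \<open>The sum is known only for \<open>x \<noteq> 0\<close>, so the constant term is
    read off as a limit.\<close>
  then have "((\<lambda>_. 0) \<longlongrightarrow> a 0) (at (0::complex))"
    by (intro powser_limit_0_strong [of 1]) auto
  then have "a 0 = 0"
    by (simp add: tendsto_const_iff)
  with k show False
    by (simp add: a_def)
qed

section \<open>The metaplectic element S\<close>

text \<open>The issue is the branch: \<open>s = csqrt \<tau>\<close> lies in the open first
  quadrant, so \<open>\<i> / s\<close> has positive real part and is the principal root of
  \<open>- 1 / \<tau>\<close>. The product is the automorphy factor of S squared.\<close>

lemma csqrt_minus_inverse_mult:
  assumes "Im \<tau> > 0"
  shows "csqrt (- 1 / \<tau>) * csqrt \<tau> = \<i>"
proof -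
  define s where "s = csqrt \<tau>"
  have s2: "s\<^sup>2 = \<tau>"
    by (simp add: s_def)
  have "s \<noteq> 0"
    using assms s2 by auto
  have "Re s \<ge> 0"
    using csqrt_principal [of \<tau>] by (auto simp: s_def)
  \<comment> \<open>This is the imaginary part of \<open>s\<^sup>2 = \<tau>\<close>; with
    \<open>Re s \<ge> 0\<close> it makes both factors positive.\<close>
  moreover have "2 * Re s * Im s > 0"
    using assms by (simp flip: s2 add: power2_eq_square)
  ultimately have "Im s > 0"
    by (simp add: zero_less_mult_iff)
  then have "Re (\<i> / s) > 0"
    by (simp add: Re_divide sum_power2_gt_zero_iff)
  moreover have "(\<i> / s)\<^sup>2 = - 1 / \<tau>"
    by (simp add: power_divide s2)
  ultimately have "csqrt (- 1 / \<tau>) = \<i> / s"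
    by (intro csqrt_unique) auto
  then show ?thesis
    using \<open>s \<noteq> 0\<close> by (simp add: s_def)
qed

lemma Mp2_S_in_carrier: "Mp2_S \<in> carrier Mp2Z"
proof -
  \<comment> \<open>The upper half plane avoids the branch cut of \<open>csqrt\<close>.\<close>
  have "\<tau> \<notin> \<real>\<^sub>\<le>\<^sub>0" if "\<tau> \<in> upper_half_plane" for \<tau>
    using that by (auto simp: upper_half_plane_def elim: nonpos_Reals_cases)
  then have "csqrt holomorphic_on upper_half_plane"
    by (intro holomorphic_intros) auto
  then have "restrict csqrt upper_half_plane holomorphic_on upper_half_plane"
    by (rule holomorphic_transform) simp
  then show ?thesis
    by (simp add: Mp2_S_def Mp2Z_def det_2 power2_csqrt)
qed

lemma moebius_action_S: "moebius_action (fst Mp2_S) \<tau> = - 1 / \<tau>"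
  by (simp add: moebius_action_def Mp2_S_def)

lemma minus_inverse_in_upper_half_plane:
  assumes "\<tau> \<in> upper_half_plane"
  shows "- 1 / \<tau> \<in> upper_half_plane"
proof -
  have "Im (- 1 / \<tau>) = Im \<tau> / ((Re \<tau>)\<^sup>2 + (Im \<tau>)\<^sup>2)"
    by (simp add: Im_divide)
  then show ?thesis
    using assms by (simp add: upper_half_plane_def sum_power2_gt_zero_iff)
qed

section \<open>The even lattice and its discriminant group\<close>

locale even_lattice_space =
  fixes B :: "'v::real_vector \<Rightarrow> 'v \<Rightarrow> real" and L :: "'v set"
  assumes even: "even_lattice B L"
begin

abbreviation D where "D \<equiv> disc_group B L"

abbreviation coset where "coset x \<equiv> L #>\<^bsub>dual_group B L\<^esub> x"

lemma bilinear: "bilinear B"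
  and sym: "B x y = B y x"
  and integral: "x \<in> L \<Longrightarrow> y \<in> L \<Longrightarrow> B x y \<in> \<int>"
  and even_norm: "x \<in> L \<Longrightarrow> B x x / 2 \<in> \<int>"
  using even by (auto simp: even_lattice_def)

lemmas B_simps =
  bilinear_ladd [OF bilinear] bilinear_radd [OF bilinear] bilinear_lneg [OF bilinear]
  bilinear_rneg [OF bilinear] bilinear_lsub [OF bilinear] bilinear_rsub [OF bilinear]
  bilinear_lzero [OF bilinear] bilinear_rzero [OF bilinear] bilinear_lmul [OF bilinear]
  bilinear_rmul [OF bilinear]

lemma
  shows zero_in_L: "0 \<in> L"
    and add_in_L: "x \<in> L \<Longrightarrow> y \<in> L \<Longrightarrow> x + y \<in> L"
    and minus_in_L: "x \<in> L \<Longrightarrow> - x \<in> L"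
proof -
  obtain S where S: "L = int_span S"
    using even by (auto simp: even_lattice_def full_lattice_def)
  have comb: "(\<Sum>b\<in>S. real_of_int (n b) *\<^sub>R b) \<in> L" for n
    by (auto simp: S int_span_def)
  show "0 \<in> L"
    using comb [of "\<lambda>_. 0"] by simp
  show "x + y \<in> L" if xy: "x \<in> L" "y \<in> L"
  proof -
    obtain m n where "x = (\<Sum>b\<in>S. real_of_int (m b) *\<^sub>R b)" "y = (\<Sum>b\<in>S. real_of_int (n b) *\<^sub>R b)"
      using xy unfolding S int_span_def by blast
    then show ?thesis
      using comb [of "\<lambda>b. m b + n b"] by (simp add: scaleR_left_distrib sum.distrib)
  qed
  show "- x \<in> L" if x: "x \<in> L"
  proof -
    obtain m where "x = (\<Sum>b\<in>S. real_of_int (m b) *\<^sub>R b)"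
      using x unfolding S int_span_def by blast
    then show ?thesis
      using comb [of "\<lambda>b. - m b"] by (simp add: sum_negf)
  qed
qed

lemma dual_group_simps [simp]:
  "carrier (dual_group B L) = dual_lattice B L"
  "mult (dual_group B L) = (+)"
  "one (dual_group B L) = 0"
  by (simp_all add: dual_group_def)

sublocale dual: comm_group "dual_group B L"
proof (rule comm_groupI)
  fix x assume "x \<in> carrier (dual_group B L)"
  then have "- x \<in> carrier (dual_group B L)"
    by (simp add: dual_lattice_def B_simps)
  then show "\<exists>y\<in>carrier (dual_group B L). y \<otimes>\<^bsub>dual_group B L\<^esub> x = \<one>\<^bsub>dual_group B L\<^esub>"
    by (rule bexI [rotated]) simp
qed (auto simp: dual_lattice_def B_simps)

lemma L_subset_dual: "L \<subseteq> dual_lattice B L"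
  using integral by (auto simp: dual_lattice_def)

lemma dual_inv: "x \<in> dual_lattice B L \<Longrightarrow> inv\<^bsub>dual_group B L\<^esub> x = - x"
  by (rule dual.inv_equality) (auto simp: dual_lattice_def B_simps)

lemma subgroup_L: "subgroup L (dual_group B L)"
proof (rule dual.subgroupI)
  fix x assume "x \<in> L"
  then show "inv\<^bsub>dual_group B L\<^esub> x \<in> L"
    using L_subset_dual dual_inv minus_in_L by auto
qed (use L_subset_dual zero_in_L add_in_L in auto)

sublocale L: normal L "dual_group B L"
  using subgroup_L by (rule dual.subgroup_imp_normal)

sublocale disc: comm_group D
  unfolding disc_group_def by (rule dual.abelian_FactGroup [OF subgroup_L])

lemma disc_eq: "disc B L = coset ` dual_lattice B L"
  by (simp add: disc_group_def carrier_FactGroup)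

lemma mem_coset_iff: "y \<in> coset x \<longleftrightarrow> y - x \<in> L"
  by (auto simp: r_coset_def intro: bexI [of _ "y - x"])

lemma disc_mult:
  assumes "x \<in> dual_lattice B L" "y \<in> dual_lattice B L"
  shows "coset x \<otimes>\<^bsub>D\<^esub> coset y = coset (x + y)"
  using L.rcos_sum assms by (simp add: disc_group_def)

lemma minus_in_dual: "x \<in> dual_lattice B L \<Longrightarrow> - x \<in> dual_lattice B L"
  by (simp add: dual_lattice_def B_simps)

lemma disc_neg_coset:
  assumes "x \<in> dual_lattice B L"
  shows "disc_neg B L (coset x) = coset (- x)"
proof (rule disc.inv_equality)
  have "coset (- x) \<otimes>\<^bsub>D\<^esub> coset x = coset 0"
    using assms minus_in_dual by (simp add: disc_mult)
  also have "\<dots> = \<one>\<^bsub>D\<^esub>"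
    by (simp add: disc_group_def r_coset_def)
  finally show "coset (- x) \<otimes>\<^bsub>D\<^esub> coset x = \<one>\<^bsub>D\<^esub>" .
qed (use assms minus_in_dual in \<open>auto simp: disc_eq\<close>)

lemma coset_representative: "(SOME y. y \<in> coset x) - x \<in> L"
proof -
  have "x \<in> coset x"
    using zero_in_L by (simp add: mem_coset_iff)
  then show ?thesis
    using someI [of "\<lambda>y. y \<in> coset x" x] by (simp add: mem_coset_iff)
qed

text \<open>\<open>disc_pairing\<close> chooses representatives and reduces modulo 1;
  \<open>ee\<close> forgets both, because moving a representative by a lattice vector changes
  \<open>B\<close> by an integer.\<close>

lemma ee_disc_pairing_coset:
  assumes "x \<in> dual_lattice B L" "y \<in> dual_lattice B L"
  shows "ee (of_real (disc_pairing B (coset x) (coset y))) = ee (of_real (B x y))"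
proof -
  define x' y' where "x' = (SOME z. z \<in> coset x)" and "y' = (SOME z. z \<in> coset y)"
  have x': "x' - x \<in> L" and y': "y' - y \<in> L"
    by (simp_all add: x'_def y'_def coset_representative)
  \<comment> \<open>The first two terms pair a dual vector with a lattice vector, the third pairs
    two lattice vectors.\<close>
  have "B x' y' - B x y = B y (x' - x) + B x (y' - y) + B (x' - x) (y' - y)"
    using sym [of x y] sym [of x' y] by (simp add: B_simps)
  also have "\<dots> \<in> \<int>"
    using assms x' y' integral [OF x' y'] unfolding dual_lattice_def by (blast intro: Ints_add)
  finally show ?thesis
    by (simp add: disc_pairing_def x'_def y'_def ee_cong_Ints)
qed

text \<open>Here evenness enters, beyond integrality: moving the representative by a lattice vector
  \<open>v\<close> contributes \<open>B v v / 2\<close>.\<close>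

lemma disc_q_coset:
  assumes "x \<in> dual_lattice B L"
  shows "disc_q B (coset x) - B x x / 2 \<in> \<int>"
proof -
  define x' where "x' = (SOME z. z \<in> coset x)"
  have x': "x' - x \<in> L"
    by (simp add: x'_def coset_representative)
  have "B x' x' / 2 - B x x / 2 = B x (x' - x) + B (x' - x) (x' - x) / 2"
    using sym [of x x'] by (simp add: B_simps field_simps)
  also have "\<dots> \<in> \<int>"
    using assms x' even_norm [OF x'] unfolding dual_lattice_def by (blast intro: Ints_add)
  finally have "B x' x' / 2 - B x x / 2 - of_int \<lfloor>B x' x' / 2\<rfloor> \<in> \<int>"
    by (rule Ints_diff) (rule Ints_of_int)
  then show ?thesis
    by (simp add: disc_q_def x'_def frac_def algebra_simps)
qed

text \<open>Opposite vectors have equal norm. This puts the exponents of the two components compared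
  by parity in the same class modulo 1.\<close>

lemma disc_q_neg:
  assumes "\<gamma> \<in> disc B L"
  shows "disc_q B (disc_neg B L \<gamma>) - disc_q B \<gamma> \<in> \<int>"
proof -
  obtain x where x: "x \<in> dual_lattice B L" "\<gamma> = coset x"
    using assms by (auto simp: disc_eq)
  then have "- x \<in> dual_lattice B L"
    by (simp add: minus_in_dual)
  then show ?thesis
    using Ints_diff [OF disc_q_coset [of "- x"] disc_q_coset [OF x(1)]] x
    by (simp add: disc_neg_coset B_simps)
qed

section \<open>Characters of the discriminant group\<close>

text \<open>Up to a constant this is the kernel of the conjugate representation at S; that of
  \<open>\<rho>\<close> itself is its complex conjugate.\<close>

definition \<psi> :: "'v set \<Rightarrow> 'v set \<Rightarrow> complex" where
  "\<psi> \<gamma> \<delta> = ee (of_real (disc_pairing B \<gamma> \<delta>))"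

lemma \<psi>_coset:
  "x \<in> dual_lattice B L \<Longrightarrow> y \<in> dual_lattice B L \<Longrightarrow> \<psi> (coset x) (coset y) = ee (of_real (B x y))"
  by (simp add: \<psi>_def ee_disc_pairing_coset)

lemma \<psi>_sym: "\<gamma> \<in> disc B L \<Longrightarrow> \<delta> \<in> disc B L \<Longrightarrow> \<psi> \<gamma> \<delta> = \<psi> \<delta> \<gamma>"
  using sym by (auto simp: disc_eq \<psi>_coset)

lemma \<psi>_mult:
  assumes "\<gamma> \<in> disc B L" "\<delta> \<in> disc B L" "\<epsilon> \<in> disc B L"
  shows "\<psi> (\<gamma> \<otimes>\<^bsub>D\<^esub> \<delta>) \<epsilon> = \<psi> \<gamma> \<epsilon> * \<psi> \<delta> \<epsilon>"
proof -
  have "x + y \<in> dual_lattice B L" if "x \<in> dual_lattice B L" "y \<in> dual_lattice B L" for x y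
    using that by (simp add: dual_lattice_def B_simps)
  then show ?thesis
    using assms by (auto simp: disc_eq disc_mult \<psi>_coset B_simps ee_add)
qed

lemma \<psi>_one: "\<epsilon> \<in> disc B L \<Longrightarrow> \<psi> \<one>\<^bsub>D\<^esub> \<epsilon> = 1"
  using \<psi>_mult [of "\<one>\<^bsub>D\<^esub>" "\<one>\<^bsub>D\<^esub>" \<epsilon>] by (simp add: \<psi>_def ee_def)

lemma cnj_\<psi>: "cnj (\<psi> \<gamma> \<delta>) = ee (- of_real (disc_pairing B \<gamma> \<delta>))"
  by (simp add: \<psi>_def cnj_ee_of_real)

text \<open>Translation by \<open>\<beta>\<close> permutes the group and multiplies the sum by
  \<open>\<psi> \<gamma> \<beta>\<close>, a factor different from 1.\<close>

lemma sum_nontrivial_character: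
  assumes "\<gamma> \<in> disc B L" "\<beta> \<in> disc B L" "\<psi> \<gamma> \<beta> \<noteq> 1"
  shows "(\<Sum>\<delta>\<in>disc B L. \<psi> \<gamma> \<delta>) = 0"
proof -
  have "(\<Sum>\<delta>\<in>disc B L. \<psi> \<gamma> \<delta>) = (\<Sum>\<delta>\<in>disc B L. \<psi> \<gamma> (\<beta> \<otimes>\<^bsub>D\<^esub> \<delta>))"
    by (rule sum.reindex_bij_witness [of _ "\<lambda>\<delta>. \<beta> \<otimes>\<^bsub>D\<^esub> \<delta>" "\<lambda>\<delta>. inv\<^bsub>D\<^esub> \<beta> \<otimes>\<^bsub>D\<^esub> \<delta>"])
      (use assms in \<open>auto simp flip: disc.m_assoc\<close>)
  also have "\<dots> = (\<Sum>\<delta>\<in>disc B L. \<psi> \<gamma> \<beta> * \<psi> \<gamma> \<delta>)"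
    using assms by (intro sum.cong refl) (simp add: \<psi>_sym [of \<gamma>] \<psi>_mult)
  also have "\<dots> = \<psi> \<gamma> \<beta> * (\<Sum>\<delta>\<in>disc B L. \<psi> \<gamma> \<delta>)"
    by (simp add: sum_distrib_left)
  finally show ?thesis
    using assms(3) by simp
qed

lemma two_torsion_neg: "two_torsion B L \<mu> \<Longrightarrow> disc_neg B L \<mu> = \<mu>"
  unfolding two_torsion_def by (rule disc.inv_equality) auto

text \<open>The pairings of \<open>\<alpha>\<close> with the lattice are multiples of
  \<open>l\<close>, so dividing by \<open>l\<close> leaves a dual vector.\<close>

lemma reflective_slot_in_disc:
  assumes "reflective_slot B L \<mu> m"
  shows "\<mu> \<in> disc B L"
proof -
  obtain \<alpha> l where l: "l > 0" "{B \<alpha> x | x. x \<in> L} = {real_of_int (l * n) | n. True}"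
    and \<mu>: "\<mu> = coset (\<alpha> /\<^sub>R real_of_int l)"
    using assms by (auto simp: reflective_slot_def)
  have "B (\<alpha> /\<^sub>R real_of_int l) y \<in> \<int>" if y: "y \<in> L" for y
  proof -
    have "B \<alpha> y \<in> {real_of_int (l * n) | n. True}"
      unfolding l(2) [symmetric] using y by blast
    then show ?thesis
      using l(1) by (auto simp: B_simps simp flip: mult.assoc)
  qed
  then show ?thesis
    by (simp add: \<mu> disc_eq dual_lattice_def)
qed

end

section \<open>The action of S under the Weil representation and its conjugate\<close>

lemma basis_vec_in_group_space: "\<gamma> \<in> disc B L \<Longrightarrow> basis_vec \<gamma> \<in> group_space B L"
  by (auto simp: basis_vec_def group_space_def)

lemma sum_basis_vec:
  assumes "finite A"
  shows "(\<Sum>\<delta>\<in>A. f \<delta> * basis_vec \<delta> \<epsilon>) = (if \<epsilon> \<in> A then f \<epsilon> else 0)"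
proof -
  have "(\<Sum>\<delta>\<in>A. f \<delta> * basis_vec \<delta> \<epsilon>) = (\<Sum>\<delta>\<in>A. if \<delta> = \<epsilon> then f \<delta> else 0)"
    by (intro sum.cong) (auto simp: basis_vec_def)
  then show ?thesis
    using assms by simp
qed

locale weil_rep = even_lattice_space B L
  for B :: "'v::real_vector \<Rightarrow> 'v \<Rightarrow> real" and L +
  fixes \<rho> :: "metaplectic \<Rightarrow> ('v set \<Rightarrow> complex) \<Rightarrow> ('v set \<Rightarrow> complex)"
  assumes weil: "weil_representation B L \<rho>"
begin

definition weil_const :: complex where
  "weil_const = ee (- 1 / 8) / of_real (sqrt (real (card (disc B L))))"

lemma rho_S_bij: "bij_betw (\<rho> Mp2_S) (group_space B L) (group_space B L)"
  using weil Mp2_S_in_carrier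
  by (auto simp: weil_representation_def hom_def BijGroup_def Bij_def Pi_iff)

lemma rho_S_linear:
  "v \<in> group_space B L \<Longrightarrow> w \<in> group_space B L \<Longrightarrow>
    \<rho> Mp2_S (\<lambda>\<gamma>. a * v \<gamma> + w \<gamma>) = (\<lambda>\<gamma>. a * \<rho> Mp2_S v \<gamma> + \<rho> Mp2_S w \<gamma>)"
  using weil Mp2_S_in_carrier unfolding weil_representation_def by blast

lemma rho_S_zero: "\<rho> Mp2_S (\<lambda>_. 0) = (\<lambda>_. 0)"
proof -
  have "(\<lambda>_. 0) \<in> group_space B L"
    by (simp add: group_space_def)
  \<comment> \<open>Linearity is available in the form \<open>a * v + w\<close>; with zero vectors
    and \<open>a = - 1\<close> the right-hand side cancels.\<close>
  from rho_S_linear [OF this this, of "- 1"] show ?thesis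
    by simp
qed

lemma rho_S_basis_raw:
  "\<gamma> \<in> disc B L \<Longrightarrow>
    \<rho> Mp2_S (basis_vec \<gamma>) = (\<lambda>\<epsilon>. weil_const * (\<Sum>\<delta>\<in>disc B L. cnj (\<psi> \<gamma> \<delta>) * basis_vec \<delta> \<epsilon>))"
  using weil unfolding weil_representation_def weil_const_def cnj_\<psi> by blast

text \<open>For an infinite discriminant group the convention \<open>card = 0\<close> would give
  \<open>\<rho> Mp2_S (basis_vec \<gamma>) = 0\<close>, contradicting injectivity.\<close>

lemma finite_disc: "finite (disc B L)"
proof (rule ccontr)
  assume "infinite (disc B L)"
  then have "\<rho> Mp2_S (basis_vec \<one>\<^bsub>D\<^esub>) = \<rho> Mp2_S (\<lambda>_. 0)"
    by (simp add: rho_S_basis_raw rho_S_zero)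
  then have "basis_vec \<one>\<^bsub>D\<^esub> = (\<lambda>_. 0)"
    using rho_S_bij by (auto simp: bij_betw_def group_space_def
        intro!: inj_onD [of "\<rho> Mp2_S" "group_space B L"] basis_vec_in_group_space)
  from fun_cong [OF this, of "\<one>\<^bsub>D\<^esub>"] show False
    by (simp add: basis_vec_def)
qed

lemma rho_S_basis:
  assumes "\<gamma> \<in> disc B L"
  shows "\<rho> Mp2_S (basis_vec \<gamma>) = (\<lambda>\<epsilon>. if \<epsilon> \<in> disc B L then weil_const * cnj (\<psi> \<gamma> \<epsilon>) else 0)"
  unfolding rho_S_basis_raw [OF assms] sum_basis_vec [OF finite_disc] by auto

text \<open>Nondegeneracy also comes from injectivity: an element pairing trivially with
  everything has the same image under \<open>\<rho> Mp2_S\<close> as the neutral element.\<close>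

lemma \<psi>_nondegenerate:
  assumes "\<gamma> \<in> disc B L" and triv: "\<And>\<beta>. \<beta> \<in> disc B L \<Longrightarrow> \<psi> \<gamma> \<beta> = 1"
  shows "\<gamma> = \<one>\<^bsub>D\<^esub>"
proof -
  have "\<rho> Mp2_S (basis_vec \<gamma>) = \<rho> Mp2_S (basis_vec \<one>\<^bsub>D\<^esub>)"
    using assms by (auto simp: rho_S_basis \<psi>_one fun_eq_iff)
  then have "basis_vec \<gamma> = basis_vec \<one>\<^bsub>D\<^esub>"
    using rho_S_bij assms(1) by (auto simp: bij_betw_def
        intro!: inj_onD [of "\<rho> Mp2_S" "group_space B L"] basis_vec_in_group_space)
  then show ?thesis
    by (metis basis_vec_def zero_neq_one)
qed

text \<open>Orthogonality of characters: by nondegeneracy only the neutral element yields the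
  trivial character.\<close>

lemma sum_\<psi>:
  assumes "\<gamma> \<in> disc B L"
  shows "(\<Sum>\<delta>\<in>disc B L. \<psi> \<gamma> \<delta>) = (if \<gamma> = \<one>\<^bsub>D\<^esub> then of_nat (card (disc B L)) else 0)"
proof (cases "\<gamma> = \<one>\<^bsub>D\<^esub>")
  case False
  then obtain \<beta> where "\<beta> \<in> disc B L" "\<psi> \<gamma> \<beta> \<noteq> 1"
    using \<psi>_nondegenerate assms by blast
  with False assms show ?thesis
    by (simp add: sum_nontrivial_character)
qed (simp add: \<psi>_one)

lemma rho_S:
  assumes v: "v \<in> group_space B L" and \<epsilon>: "\<epsilon> \<in> disc B L"
  shows "\<rho> Mp2_S v \<epsilon> = weil_const * (\<Sum>\<gamma>\<in>disc B L. v \<gamma> * cnj (\<psi> \<gamma> \<epsilon>))"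
proof -
  \<comment> \<open>Linearity adds one vector at a time, so the basis formula is extended by
    induction over finite sets of cosets.\<close>
  have partial: "\<rho> Mp2_S (\<lambda>\<delta>. \<Sum>\<gamma>\<in>A. v \<gamma> * basis_vec \<gamma> \<delta>) =
      (\<lambda>\<delta>. \<Sum>\<gamma>\<in>A. v \<gamma> * \<rho> Mp2_S (basis_vec \<gamma>) \<delta>)"
    if "finite A" "A \<subseteq> disc B L" for A
    using that
  proof (induction A rule: finite_induct)
    case empty
    then show ?case
      by (simp add: rho_S_zero)
  next
    case (insert \<beta> A)
    have "(\<lambda>\<delta>. \<Sum>\<gamma>\<in>A. v \<gamma> * basis_vec \<gamma> \<delta>) \<in> group_space B L"
      using insert.prems by (auto simp: group_space_def basis_vec_def intro!: sum.neutral)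
    with insert show ?case
      by (simp add: rho_S_linear basis_vec_in_group_space)
  qed
  have "v = (\<lambda>\<delta>. \<Sum>\<gamma>\<in>disc B L. v \<gamma> * basis_vec \<gamma> \<delta>)"
    unfolding sum_basis_vec [OF finite_disc] using v by (auto simp: group_space_def)
  then have "\<rho> Mp2_S v \<epsilon> = (\<Sum>\<gamma>\<in>disc B L. v \<gamma> * \<rho> Mp2_S (basis_vec \<gamma>) \<epsilon>)"
    using partial [OF finite_disc order_refl] by simp
  then show ?thesis
    using \<epsilon> by (simp add: rho_S_basis sum_distrib_left mult_ac)
qed

lemma cnj_in_group_space: "v \<in> group_space B L \<Longrightarrow> (\<lambda>\<delta>. cnj (v \<delta>)) \<in> group_space B L"
  by (simp add: group_space_def)

lemma conj_rep_S_in_group_space: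
  assumes "v \<in> group_space B L"
  shows "conj_rep \<rho> Mp2_S v \<in> group_space B L"
  unfolding conj_rep_def
  using bij_betwE [OF rho_S_bij] cnj_in_group_space assms by (intro cnj_in_group_space) auto

lemma conj_rep_S:
  assumes "v \<in> group_space B L" "\<epsilon> \<in> disc B L"
  shows "conj_rep \<rho> Mp2_S v \<epsilon> = cnj weil_const * (\<Sum>\<gamma>\<in>disc B L. v \<gamma> * \<psi> \<gamma> \<epsilon>)"
  using rho_S [OF cnj_in_group_space [OF assms(1)] assms(2)] by (simp add: conj_rep_def)

text \<open>The conjugated eighth root of unity squares to \<open>ee (1/4)\<close>, and the
  cardinality cancels the squared normalisation. The signature is encoded in this phase.\<close>

lemma cnj_weil_const_squared: "cnj weil_const ^ 2 * of_nat (card (disc B L)) = \<i>"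
proof -
  have "card (disc B L) > 0"
    using finite_disc disc.one_closed by (auto simp: card_gt_0_iff)
  moreover have "cnj (ee (- 1 / 8)) ^ 2 = \<i>"
    using cnj_ee_of_real [of "- 1 / 8"] ee_add [of "1/8" "1/8"]
    by (simp add: power2_eq_square ee_quarter)
  ultimately show ?thesis
    by (simp add: weil_const_def power_divide flip: of_real_power)
qed

text \<open>Fourier inversion on a finite abelian group: transforming twice reflects the function,
  and the squared constant leaves \<open>\<i>\<close>.\<close>

lemma conj_rep_S_twice:
  assumes v: "v \<in> group_space B L" and \<epsilon>: "\<epsilon> \<in> disc B L"
  shows "conj_rep \<rho> Mp2_S (conj_rep \<rho> Mp2_S v) \<epsilon> = \<i> * v (disc_neg B L \<epsilon>)"
proof -
  have "conj_rep \<rho> Mp2_S (conj_rep \<rho> Mp2_S v) \<epsilon> =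
      cnj weil_const * (\<Sum>\<delta>\<in>disc B L. (cnj weil_const * (\<Sum>\<gamma>\<in>disc B L. v \<gamma> * \<psi> \<gamma> \<delta>)) * \<psi> \<delta> \<epsilon>)"
    using v \<epsilon> by (simp add: conj_rep_S conj_rep_S_in_group_space)
  also have "\<dots> = cnj weil_const ^ 2 * (\<Sum>\<delta>\<in>disc B L. \<Sum>\<gamma>\<in>disc B L. v \<gamma> * (\<psi> \<gamma> \<delta> * \<psi> \<delta> \<epsilon>))"
    by (simp add: power2_eq_square sum_distrib_left sum_distrib_right mult_ac)
  also have "(\<Sum>\<delta>\<in>disc B L. \<Sum>\<gamma>\<in>disc B L. v \<gamma> * (\<psi> \<gamma> \<delta> * \<psi> \<delta> \<epsilon>)) =
      (\<Sum>\<gamma>\<in>disc B L. \<Sum>\<delta>\<in>disc B L. v \<gamma> * (\<psi> \<gamma> \<delta> * \<psi> \<delta> \<epsilon>))"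
    by (rule sum.swap)
  \<comment> \<open>By symmetry of \<open>\<psi>\<close> the two kernels merge into one character in
    \<open>\<delta>\<close>, ready for orthogonality.\<close>
  also have "\<dots> = (\<Sum>\<gamma>\<in>disc B L. v \<gamma> * (\<Sum>\<delta>\<in>disc B L. \<psi> (\<gamma> \<otimes>\<^bsub>D\<^esub> \<epsilon>) \<delta>))"
    using \<epsilon> by (simp add: sum_distrib_left \<psi>_mult \<psi>_sym [of _ \<epsilon>])
  also have "\<dots> = (\<Sum>\<gamma>\<in>disc B L.
      if \<gamma> = disc_neg B L \<epsilon> then v \<gamma> * of_nat (card (disc B L)) else 0)"
  proof (rule sum.cong [OF refl])
    fix \<gamma> assume \<gamma>: "\<gamma> \<in> disc B L"
    have "\<gamma> \<otimes>\<^bsub>D\<^esub> \<epsilon> = \<one>\<^bsub>D\<^esub> \<longleftrightarrow> \<gamma> = disc_neg B L \<epsilon>"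
      using \<gamma> \<epsilon> disc.inv_equality by fastforce
    then show "v \<gamma> * (\<Sum>\<delta>\<in>disc B L. \<psi> (\<gamma> \<otimes>\<^bsub>D\<^esub> \<epsilon>) \<delta>) =
        (if \<gamma> = disc_neg B L \<epsilon> then v \<gamma> * of_nat (card (disc B L)) else 0)"
      using \<gamma> \<epsilon> by (simp add: sum_\<psi>)
  qed
  also have "\<dots> = v (disc_neg B L \<epsilon>) * of_nat (card (disc B L))"
    using \<epsilon> finite_disc by simp
  also have "cnj weil_const ^ 2 * \<dots> = \<i> * v (disc_neg B L \<epsilon>)"
    by (simp flip: cnj_weil_const_squared)
  finally show ?thesis .
qed

text \<open>The two conjugations in \<open>conj_rep\<close> cancel on scalars. This lets
  \<open>csqrt \<tau>\<close> pass through the second application of S.\<close>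

lemma conj_rep_S_scale:
  assumes "v \<in> group_space B L" "\<epsilon> \<in> disc B L"
  shows "conj_rep \<rho> Mp2_S (\<lambda>\<gamma>. a * v \<gamma>) \<epsilon> = a * conj_rep \<rho> Mp2_S v \<epsilon>"
proof -
  have "(\<lambda>\<gamma>. a * v \<gamma>) \<in> group_space B L"
    using assms(1) by (simp add: group_space_def)
  then show ?thesis
    using assms by (simp add: conj_rep_S sum_distrib_left mult_ac)
qed

section \<open>Parity of forms of weight 1/2 and of their coefficients\<close>

lemma weight_half_S:
  assumes F: "weakly_holomorphic_form B L \<rho> (1/2) F" and \<tau>: "\<tau> \<in> upper_half_plane"
  shows "F (- 1 / \<tau>) = (\<lambda>\<gamma>. csqrt \<tau> * conj_rep \<rho> Mp2_S (F \<tau>) \<gamma>)"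
proof -
  have "\<forall>(A, \<phi>)\<in>carrier Mp2Z. \<forall>\<tau>\<in>upper_half_plane.
      F (moebius_action A \<tau>) = (\<lambda>\<gamma>. \<phi> \<tau> powi \<lfloor>2 * (1/2 :: real)\<rfloor> * conj_rep \<rho> (A, \<phi>) (F \<tau>) \<gamma>)"
    using F unfolding weakly_holomorphic_form_def by blast
  from bspec [OF this Mp2_S_in_carrier]
  have "F (moebius_action (fst Mp2_S) \<tau>) =
      (\<lambda>\<gamma>. snd Mp2_S \<tau> powi \<lfloor>2 * (1/2 :: real)\<rfloor> * conj_rep \<rho> Mp2_S (F \<tau>) \<gamma>)"
    using \<tau> by (simp add: case_prod_beta)
  \<comment> \<open>At weight 1/2 the exponent of the automorphy factor is 1, so the factor is
    \<open>csqrt \<tau>\<close> itself.\<close>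
  then show ?thesis
    using \<tau> unfolding moebius_action_S by (simp add: Mp2_S_def)
qed

lemma weight_half_odd:
  assumes F: "weakly_holomorphic_form B L \<rho> (1/2) F"
    and \<gamma>: "\<gamma> \<in> disc B L" and \<tau>: "\<tau> \<in> upper_half_plane"
  shows "F \<tau> (disc_neg B L \<gamma>) = - F \<tau> \<gamma>"
proof -
  have Fsp: "F \<tau> \<in> group_space B L"
    using F \<tau> by (simp add: weakly_holomorphic_form_def)
  have "F \<tau> \<gamma> = F (- 1 / (- 1 / \<tau>)) \<gamma>"
    by simp
  also have "\<dots> = csqrt (- 1 / \<tau>) * conj_rep \<rho> Mp2_S (F (- 1 / \<tau>)) \<gamma>"
    using weight_half_S [OF F minus_inverse_in_upper_half_plane [OF \<tau>]] by simp
  also have "\<dots> = csqrt (- 1 / \<tau>) * csqrt \<tau> * conj_rep \<rho> Mp2_S (conj_rep \<rho> Mp2_S (F \<tau>)) \<gamma>"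
    using \<gamma> Fsp unfolding weight_half_S [OF F \<tau>]
    by (simp add: conj_rep_S_scale conj_rep_S_in_group_space)
  also have "csqrt (- 1 / \<tau>) * csqrt \<tau> = \<i>"
    using \<tau> by (intro csqrt_minus_inverse_mult) (simp add: upper_half_plane_def)
  \<comment> \<open>The double transform contributes a second \<open>\<i>\<close>; the two together
    give the sign.\<close>
  also have "\<i> * conj_rep \<rho> Mp2_S (conj_rep \<rho> Mp2_S (F \<tau>)) \<gamma> = - F \<tau> (disc_neg B L \<gamma>)"
    using Fsp \<gamma> by (simp add: conj_rep_S_twice flip: mult.assoc)
  finally show ?thesis
    by simp
qed

text \<open>Since \<open>c\<close> is an arbitrary expansion, parity of the values passes to it only
  through uniqueness: the sums of opposite coefficients expand the zero function.\<close>

lemma weight_half_coeff_odd: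
  assumes F: "weakly_holomorphic_form B L \<rho> (1/2) F" and c: "fourier_expansion B L F c"
    and \<gamma>: "\<gamma> \<in> disc B L"
  shows "c (disc_neg B L \<gamma>) n = - c \<gamma> n"
proof -
  let ?c = "\<lambda>n. c (disc_neg B L \<gamma>) n + c \<gamma> n"
  obtain N where N: "\<And>\<gamma> n. n < N \<Longrightarrow> c \<gamma> n = 0"
    using c by (auto simp: fourier_expansion_def)
  have supp: "c \<gamma> n \<noteq> 0 \<Longrightarrow> n + disc_q B \<gamma> \<in> \<int>" for \<gamma> n
    using c by (auto simp: fourier_expansion_def)
  have "?c n = 0"
  proof (rule fourier_coeffs_eq_0 [where r = "disc_q B \<gamma>" and N = N])
    fix n assume "?c n \<noteq> 0"
    then have "c (disc_neg B L \<gamma>) n \<noteq> 0 \<or> c \<gamma> n \<noteq> 0"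
      by auto
    then show "n + disc_q B \<gamma> \<in> \<int>"
    proof
      assume "c (disc_neg B L \<gamma>) n \<noteq> 0"
      \<comment> \<open>The value of \<open>disc_q\<close> at the negative is exchanged for that at
        \<open>\<gamma>\<close>, from which it differs by an integer.\<close>
      from Ints_diff [OF supp [OF this] disc_q_neg [OF \<gamma>]] show ?thesis
        by simp
    qed (rule supp)
  next
    fix \<tau> :: complex assume "Im \<tau> > 0"
    then have \<tau>: "\<tau> \<in> upper_half_plane"
      by (simp add: upper_half_plane_def)
    have "((\<lambda>n. c \<delta> n * ee (of_real n * \<tau>)) has_sum F \<tau> \<delta>) UNIV" if "\<delta> \<in> disc B L" for \<delta>
      using c \<tau> that by (simp add: fourier_expansion_def)
    from has_sum_add [OF this [OF disc.inv_closed [OF \<gamma>]] this [OF \<gamma>]]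
    show "((\<lambda>n. ?c n * ee (of_real n * \<tau>)) has_sum 0) UNIV"
      using weight_half_odd [OF F \<gamma> \<tau>] by (simp add: ring_distribs)
  qed (simp add: N)
  then show ?thesis
    by (simp add: add_eq_0_iff2)
qed

end

section \<open>Torsion cosets and reflective prescriptions\<close>

theorem lemma9p1:
  fixes B :: "'v::real_vector \<Rightarrow> 'v \<Rightarrow> real"
    and L :: "'v set"
    and \<rho> :: "metaplectic \<Rightarrow> ('v set \<Rightarrow> complex) \<Rightarrow> ('v set \<Rightarrow> complex)"
  assumes "even_lattice B L"
    and "has_signature B 2 1"
    and "weil_representation B L \<rho>"
  shows
    "(\<forall>F. weakly_holomorphic_form B L \<rho> (1/2) F \<longrightarrow>
        (\<forall>\<gamma>\<in>disc B L. \<forall>\<tau>\<in>upper_half_plane. F \<tau> (disc_neg B L \<gamma>) = - F \<tau> \<gamma>)) \<and>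
     (\<forall>F \<mu>. weakly_holomorphic_form B L \<rho> (1/2) F \<and> two_torsion B L \<mu> \<longrightarrow>
        (\<forall>\<tau>\<in>upper_half_plane. F \<tau> \<mu> = 0) \<and>
        (\<forall>c. fourier_expansion B L F c \<longrightarrow> (\<forall>n. c \<mu> n = 0))) \<and>
     (\<forall>\<mu> m. reflective_slot B L \<mu> m \<and> two_torsion B L \<mu> \<longrightarrow>
        invisible_slot B L \<rho> (1/2) \<mu> m) \<and>
     (\<forall>F a. weakly_holomorphic_form B L \<rho> (1/2) F \<and> has_principal_part B L F a \<and>
        reflective_prescription B L a \<longrightarrow> available_at_half B L a) \<and>
     (\<forall>a. reflective_prescription B L a \<longrightarrow>
        (available_at_half B L a \<longleftrightarrow>
           (\<forall>\<mu> m. a \<mu> m \<noteq> 0 \<longrightarrow>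
              reflective_slot B L \<mu> m \<and> reflective_slot B L (disc_neg B L \<mu>) m \<and>
              \<not> two_torsion B L \<mu> \<and> a (disc_neg B L \<mu>) m = - a \<mu> m)))"
proof -
  interpret weil_rep B L \<rho>
    using assms by unfold_locales
  \<comment> \<open>A two-torsion coset is its own negative, so parity makes the component equal to
    minus itself.\<close>
  have torsion: "F \<tau> \<mu> = 0"
    if "weakly_holomorphic_form B L \<rho> (1/2) F" "two_torsion B L \<mu>" "\<tau> \<in> upper_half_plane" for F \<mu> \<tau>
    using weight_half_odd [of F \<mu> \<tau>] that two_torsion_neg [of \<mu>] by (simp add: two_torsion_def)
  have torsion_coeff: "c \<mu> n = 0"
    if "weakly_holomorphic_form B L \<rho> (1/2) F" "fourier_expansion B L F c" "two_torsion B L \<mu>"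
    for F c \<mu> n
    using weight_half_coeff_odd [of F c \<mu> n] that two_torsion_neg [of \<mu>]
    by (simp add: two_torsion_def)
  have available: "available_at_half B L a \<longleftrightarrow>
      (\<forall>\<mu> m. a \<mu> m \<noteq> 0 \<longrightarrow>
         reflective_slot B L \<mu> m \<and> reflective_slot B L (disc_neg B L \<mu>) m \<and>
         \<not> two_torsion B L \<mu> \<and> a (disc_neg B L \<mu>) m = - a \<mu> m)" (is "_ \<longleftrightarrow> ?odd")
    if a: "reflective_prescription B L a" for a
  proof
    have slot: "a \<mu> m \<noteq> 0 \<Longrightarrow> reflective_slot B L \<mu> m" for \<mu> m
      using a by (simp add: reflective_prescription_def)
    assume "available_at_half B L a"
    then have neg: "a (disc_neg B L \<mu>) m = - a \<mu> m" if "\<mu> \<in> disc B L" for \<mu> m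
      using that by (simp add: available_at_half_def)
    show ?odd
    proof (intro allI impI conjI)
      fix \<mu> m assume nz: "a \<mu> m \<noteq> 0"
      then have \<mu>: "\<mu> \<in> disc B L"
        using slot reflective_slot_in_disc by blast
      \<comment> \<open>A nonzero coefficient at \<open>\<mu>\<close> forces one at its negative, so
        both are in the support.\<close>
      show "reflective_slot B L \<mu> m" "reflective_slot B L (disc_neg B L \<mu>) m"
        using nz neg [OF \<mu>] by (auto intro: slot)
      show "\<not> two_torsion B L \<mu>"
        using nz neg [OF \<mu>, of m] two_torsion_neg [of \<mu>] by auto
      show "a (disc_neg B L \<mu>) m = - a \<mu> m"
        by (rule neg [OF \<mu>])
    qed
  next
    assume odd: ?odd
    have "a (disc_neg B L \<mu>) m = - a \<mu> m" if \<mu>: "\<mu> \<in> disc B L" for \<mu> m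
    \<comment> \<open>\<open>?odd\<close> constrains only nonzero coefficients. If the one at
      \<open>\<mu>\<close> vanishes and the opposite one does not, it is applied at the negative,
      and double negation returns to \<open>\<mu>\<close>.\<close>
    proof (cases "a \<mu> m = 0 \<and> a (disc_neg B L \<mu>) m \<noteq> 0")
      case True
      with odd have "a (disc_neg B L (disc_neg B L \<mu>)) m = - a (disc_neg B L \<mu>) m"
        by blast
      with True \<mu> show ?thesis
        by simp
    next
      case False
      with odd show ?thesis
        by (cases "a \<mu> m = 0") auto
    qed
    with a show "available_at_half B L a"
      by (simp add: available_at_half_def)
  qed
  \<comment> \<open>For \<open>m > 0\<close> this is coefficient parity at exponent
    \<open>- m\<close>; otherwise both values are the default 0.\<close>
  have principal: "available_at_half B L a"
    if F: "weakly_holomorphic_form B L \<rho> (1/2) F" and pp: "has_principal_part B L F a"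
      and a: "reflective_prescription B L a" for F a
  proof -
    obtain c where "fourier_expansion B L F c" "a = (\<lambda>\<mu> m. if m > 0 then c \<mu> (- m) else 0)"
      using pp by (auto simp: has_principal_part_def)
    then show ?thesis
      using a weight_half_coeff_odd [OF F] by (simp add: available_at_half_def)
  qed
  show ?thesis
    using weight_half_odd torsion torsion_coeff principal available
    unfolding invisible_slot_def by blast
qed

end
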